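(* The map $\mathtt{M}:(\mathfrak{A}^0,\,\sqcup\!\sqcup)\to\mathbb{R}$, $\mathtt{M}(w)=\int_0^1 w$, is a homomorphism of $\mathbb{Q}$-algebras, where $\sqcup\!\sqcup$ is the shuffle product.
   Context: Put $\omega_0=\frac{dt}{t}$, $\omega_{+1}^{-1}=\frac{2\,dt}{1-t^2}$, $\omega_{-1}^{-1}=\frac{-2\,dt}{1+t^2}$, $\omega_{+1}^{+1}=\frac{2t\,dt}{1-t^2}$, $\omega_{-1}^{+1}=\frac{-2t\,dt}{1+t^2}$. Let $\mathfrak{A}$ be the noncommutative polynomial $\mathbb{Q}$-algebra of words (including the empty word) in the letters $\omega_0$ and $\omega_\sigma^\varepsilon$ ($\sigma,\varepsilon=\pm1$). $\mathfrak{A}^0$ is the $\mathbb{Q}$-span of the admissible words: the empty word and the words not beginning with $\omega_{+1}^{+1}$ or $\omega_{+1}^{-1}$ and not ending with $\omega_0$. For an admissible word, $\int_0^1 f_1(t)dt\cdots f_p(t)dt=\int_{1>t_1>\cdots>t_p>0}f_1(t_1)\cdots f_p(t_p)\,dt_1\cdots dt_p$, with value $1$ on the empty word, and $\mathtt{M}$ is extended $\mathbb{Q}$-linearly. The shuffle product is the usual one on words: bilinear, with the empty word as unit, and $au\sqcup\!\sqcup bv=a(u\sqcup\!\sqcup bv)+b(au\sqcup\!\sqcup v)$ for letters $a,b$ and words $u,v$. *)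

theory Defs
  imports "HOL-Algebra.Module" "HOL-Algebra.RingHom" "HOL-Analysis.Analysis" "HOL-Library.Poly_Mapping"
begin

section \<open>Words and their rational linear combinations\<close>

datatype sgn1 = Plus | Minus

text \<open>\<open>Om \<sigma> \<epsilon>\<close> is the letter with lower index \<open>\<sigma>\<close> and upper index \<open>\<epsilon>\<close>.\<close>

datatype letter = Om0 | Om sgn1 sgn1

text \<open>The coefficient \<open>f\<close> of the differential form \<open>f(t) dt\<close>.\<close>

fun form_coeff :: "letter \<Rightarrow> real \<Rightarrow> real" where
  "form_coeff Om0 t = 1 / t"
| "form_coeff (Om Plus Minus) t = 2 / (1 - t^2)"
| "form_coeff (Om Minus Minus) t = - 2 / (1 + t^2)"
| "form_coeff (Om Plus Plus) t = 2 * t / (1 - t^2)"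
| "form_coeff (Om Minus Plus) t = - 2 * t / (1 + t^2)"

text \<open>
  The underlying rational vector space of the noncommutative polynomial algebra on \<open>'a\<close>:
  finitely supported functions from words to coefficients. Its concatenation product
  enters only through left multiplication by a letter.
\<close>

type_synonym 'a ncpoly = "'a list \<Rightarrow>\<^sub>0 rat"

abbreviation word :: "'a list \<Rightarrow> 'a ncpoly" where
  "word w \<equiv> Poly_Mapping.single w 1"

definition nc_scale :: "rat \<Rightarrow> 'a ncpoly \<Rightarrow> 'a ncpoly" where
  "nc_scale c p = Poly_Mapping.map (\<lambda>x. c * x) p"

lemma lookup_nc_scale [simp]: "Poly_Mapping.lookup (nc_scale c p) w = c * Poly_Mapping.lookup p w"
  by (simp add: nc_scale_def Poly_Mapping.map.rep_eq when_def)

interpretation ncpoly: vector_space nc_scale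
  by unfold_locales (auto intro!: poly_mapping_eqI simp: lookup_add algebra_simps)

definition lmult :: "'a \<Rightarrow> 'a ncpoly \<Rightarrow> 'a ncpoly" where
  "lmult a p = (\<Sum>w\<in>Poly_Mapping.keys p. nc_scale (Poly_Mapping.lookup p w) (word (a # w)))"


section \<open>The shuffle product\<close>

fun shuffle_words :: "'a list \<Rightarrow> 'a list \<Rightarrow> 'a ncpoly" where
  "shuffle_words [] v = word v"
| "shuffle_words u [] = word u"
| "shuffle_words (a # u) (b # v) =
     lmult a (shuffle_words u (b # v)) + lmult b (shuffle_words (a # u) v)"

definition shuffle :: "'a ncpoly \<Rightarrow> 'a ncpoly \<Rightarrow> 'a ncpoly" where
  "shuffle p q = (\<Sum>u\<in>Poly_Mapping.keys p. \<Sum>v\<in>Poly_Mapping.keys q.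
     nc_scale (Poly_Mapping.lookup p u * Poly_Mapping.lookup q v) (shuffle_words u v))"


section \<open>Admissible words and iterated integrals\<close>

definition admissible :: "letter list \<Rightarrow> bool" where
  "admissible w \<longleftrightarrow> w = [] \<or>
     (hd w \<noteq> Om Plus Plus \<and> hd w \<noteq> Om Plus Minus \<and> last w \<noteq> Om0)"

definition admissible_span :: "letter ncpoly set" where
  "admissible_span = ncpoly.span (word ` {w. admissible w})"

text \<open>
  Words of length \<open>p\<close> are integrated over \<open>1 > t\<^sub>0 > \<dots> > t\<^bsub>p-1\<^esub> > 0\<close> with respect to
  \<open>p\<close>-dimensional Lebesgue measure, the outermost variable belonging to the first letter. For
  \<open>p = 0\<close> the measure space is a single point of mass one, so the empty word has integral one.
\<close>

abbreviation lborel_pow :: "nat \<Rightarrow> (nat \<Rightarrow> real) measure" where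
  "lborel_pow p \<equiv> Pi\<^sub>M {..<p} (\<lambda>_. lborel)"

definition open_simplex :: "nat \<Rightarrow> (nat \<Rightarrow> real) set" where
  "open_simplex p = {t \<in> space (lborel_pow p).
     (\<forall>i<p. 0 < t i \<and> t i < 1) \<and> (\<forall>i j. i < j \<and> j < p \<longrightarrow> t j < t i)}"

definition integrand :: "letter list \<Rightarrow> (nat \<Rightarrow> real) \<Rightarrow> real" where
  "integrand w t = (\<Prod>i<length w. form_coeff (w ! i) (t i))"

definition word_convergent :: "letter list \<Rightarrow> bool" where
  "word_convergent w \<longleftrightarrow>
     set_integrable (lborel_pow (length w)) (open_simplex (length w)) (integrand w)"

definition word_integral :: "letter list \<Rightarrow> real" where
  "word_integral w = (LINT t:open_simplex (length w)|lborel_pow (length w). integrand w t)"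

lemma word_integral_Nil: "word_integral [] = 1"
proof -
  have "open_simplex 0 = space (lborel_pow 0)" by (simp add: open_simplex_def)
  then show ?thesis
    by (simp add: word_integral_def integrand_def set_lebesgue_integral_def
        PiM_empty lebesgue_integral_count_space_finite)
qed

definition M :: "letter ncpoly \<Rightarrow> real" where
  "M p = (\<Sum>w\<in>Poly_Mapping.keys p. of_rat (Poly_Mapping.lookup p w) * word_integral w)"


section \<open>Algebras over the rationals\<close>

definition rat_ring :: "rat ring" where
  "rat_ring = \<lparr>carrier = UNIV, monoid.mult = (*), one = 1, ring.zero = 0, add = (+)\<rparr>"

definition admissible_algebra :: "(rat, letter ncpoly) module" where
  "admissible_algebra = \<lparr>carrier = admissible_span, monoid.mult = shuffle, one = word [],
     ring.zero = 0, add = (+), module.smult = nc_scale\<rparr>"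

definition real_rat_algebra :: "(rat, real) module" where
  "real_rat_algebra = \<lparr>carrier = UNIV, monoid.mult = (*), one = 1,
     ring.zero = 0, add = (+), module.smult = (\<lambda>c x. of_rat c * x)\<rparr>"

text \<open>
  \<open>Module.algebra\<close> is the notion of a unital commutative algebra over a commutative ring;
  the unqualified name is ambiguous with the algebras of sets of measure theory.
\<close>

definition algebra_hom ::
  "('r, 'm) ring_scheme \<Rightarrow> ('r, 'a, 'x) module_scheme \<Rightarrow> ('r, 'b, 'y) module_scheme \<Rightarrow> ('a \<Rightarrow> 'b) \<Rightarrow> bool"
  where "algebra_hom R A B h \<longleftrightarrow>
     Module.algebra R A \<and> Module.algebra R B \<and> h \<in> ring_hom A B \<and>
     (\<forall>c\<in>carrier R. \<forall>x\<in>carrier A. h (c \<odot>\<^bsub>A\<^esub> x) = c \<odot>\<^bsub>B\<^esub> h x)"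

end

theory Submission
  imports Defs
begin

text \<open>
  Since every letter has constant sign on \<open>(0, 1)\<close>, an iterated integral is, up to sign, an iterated
  integral of nonnegative functions, and the latter always exists in \<open>[0, \<infinity>]\<close>. There the shuffle
  identity holds without convergence hypotheses: by Tonelli, the square over which a product of two
  integrals is taken splits into the triangles \<open>s > t\<close> and \<open>t > s\<close>, the diagonal being null, which
  is the recursion of the shuffle product. Shuffles of admissible words are admissible, and for
  admissible words the integrals are finite, so that one can return to the reals.
\<close>

section \<open>The shuffle algebra\<close>

text \<open>Words span all polynomials, and \<open>0\<close> is a word scaled by zero. The rule
  reduces multilinear identities to identities between words.\<close>

lemma ncpoly_induct [case_names word add scale]:
  assumes word: "\<And>w. P (word w)"
    and add: "\<And>p q. P p \<Longrightarrow> P q \<Longrightarrow> P (p + q)"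
    and scale: "\<And>c p. P p \<Longrightarrow> P (nc_scale c p)"
  shows "P p"
proof -
  have zero: "P 0"
    using scale[OF word, of 0] by simp
  have "P (\<Sum>w\<in>S. nc_scale (Poly_Mapping.lookup p w) (word w))" if "finite S" for S
    using that by induction (auto intro: zero word add scale)
  moreover have "p = (\<Sum>w\<in>Poly_Mapping.keys p. nc_scale (Poly_Mapping.lookup p w) (word w))"
    by (rule poly_mapping_eqI)
      (auto simp: lookup_sum lookup_single when_def in_keys_iff if_distrib cong: if_cong)
  ultimately show ?thesis
    by (metis finite_keys)
qed

text \<open>Scaling can only shrink the support, strictly when \<open>c = 0\<close>; the keys that
  get lost contribute \<open>f k 0 = 0\<close>.\<close>

lemma sum_keys_nc_scale:
  assumes "\<And>k. f k 0 = 0"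
  shows "(\<Sum>k\<in>Poly_Mapping.keys (nc_scale c p). f k (Poly_Mapping.lookup (nc_scale c p) k)) =
    (\<Sum>k\<in>Poly_Mapping.keys p. f k (c * Poly_Mapping.lookup p k))"
  by (rule sum.mono_neutral_cong_left) (auto simp: in_keys_iff assms)

lemma lmult_word [simp]: "lmult a (word w) = word (a # w)"
  by (simp add: lmult_def)

lemma lmult_add: "lmult a (p + q) = lmult a p + lmult a q"
  unfolding lmult_def
  by (rule setsum_keys_plus_distrib) (simp_all add: ncpoly.scale_left_distrib)

lemma lmult_scale: "lmult a (nc_scale c p) = nc_scale c (lmult a p)"
  unfolding lmult_def
  by (subst sum_keys_nc_scale) (simp_all add: ncpoly.scale_sum_right)

section \<open>Bilinearity, commutativity and associativity of the shuffle product\<close>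

lemma shuffle_word_word: "shuffle (word u) (word v) = shuffle_words u v"
  by (simp add: shuffle_def)

lemma shuffle_add_left: "shuffle (p + q) r = shuffle p r + shuffle q r"
  unfolding shuffle_def
  by (rule setsum_keys_plus_distrib)
    (simp_all add: ncpoly.scale_left_distrib distrib_right sum.distrib)

lemma shuffle_add_right: "shuffle r (p + q) = shuffle r p + shuffle r q"
  unfolding shuffle_def sum.distrib[symmetric]
  by (intro sum.cong refl setsum_keys_plus_distrib)
    (simp_all add: ncpoly.scale_left_distrib distrib_left)

lemma shuffle_scale_left: "shuffle (nc_scale c p) q = nc_scale c (shuffle p q)"
  unfolding shuffle_def
  by (subst sum_keys_nc_scale) (simp_all add: ncpoly.scale_sum_right mult.assoc)

lemma shuffle_scale_right: "shuffle p (nc_scale c q) = nc_scale c (shuffle p q)"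
  unfolding shuffle_def
  by (subst sum_keys_nc_scale) (simp_all add: ncpoly.scale_sum_right mult.left_commute)

lemmas shuffle_bilinear = shuffle_add_left shuffle_add_right shuffle_scale_left shuffle_scale_right

lemma shuffle_words_Nil_right [simp]: "shuffle_words u [] = word u"
  by (cases u) auto

lemma shuffle_words_commute: "shuffle_words u v = shuffle_words v u"
  by (induction u v rule: shuffle_words.induct) (simp_all add: add.commute)

lemma shuffle_commute: "shuffle p q = shuffle q p"
proof (induction p rule: ncpoly_induct)
  case (word u)
  show ?case
    by (induction q rule: ncpoly_induct)
      (simp_all add: shuffle_bilinear shuffle_word_word shuffle_words_commute)
qed (simp_all add: shuffle_bilinear)

lemma shuffle_one_left: "shuffle (word []) p = p"
  by (induction p rule: ncpoly_induct) (simp_all add: shuffle_bilinear shuffle_word_word)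

lemma shuffle_one_right: "shuffle p (word []) = p"
  using shuffle_one_left shuffle_commute by metis

text \<open>Bilinear extension of the defining recursion. Associativity needs it because the inner
  shuffle there is a polynomial and not a single word.\<close>

lemma shuffle_lmult_lmult:
  "shuffle (lmult a p) (lmult b q) =
    lmult a (shuffle p (lmult b q)) + lmult b (shuffle (lmult a p) q)"
proof (induction p rule: ncpoly_induct)
  case (word u)
  show ?case
    by (induction q rule: ncpoly_induct)
      (simp_all add: shuffle_bilinear shuffle_word_word lmult_add lmult_scale ncpoly.scale_right_distrib)
qed (simp_all add: shuffle_bilinear lmult_add lmult_scale ncpoly.scale_right_distrib)

text \<open>For nonempty words both sides expand into three terms, according to which of the three
  first letters comes first. The remaining triple shuffles have smaller total length.\<close>

lemma shuffle_assoc_words: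
  "shuffle (shuffle (word u) (word v)) (word w) = shuffle (word u) (shuffle (word v) (word w))"
proof (induction "length u + length v + length w" arbitrary: u v w rule: less_induct)
  case less
  show ?case
  proof (cases "u = [] \<or> v = [] \<or> w = []")
    case True
    then show ?thesis
      by (auto simp: shuffle_one_left shuffle_one_right)
  next
    case False
    then obtain a u' b v' c w' where u: "u = a # u'" and v: "v = b # v'" and w: "w = c # w'"
      by (metis list.exhaust)
    \<comment> \<open>Opaque names keep \<open>lmult_word\<close> from folding the first letters
      back into the words, so that \<open>shuffle_lmult_lmult\<close> applies.\<close>
    define p q r where "p = word u'" and "q = word v'" and "r = word w'"
    have words: "word u = lmult a p" "word v = lmult b q" "word w = lmult c r"
      by (simp_all add: u v w p_def q_def r_def)
    have IH1: "shuffle (shuffle p (lmult b q)) (lmult c r) = shuffle p (shuffle (lmult b q) (lmult c r))"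
      using less[of u' v w] by (simp add: u v w p_def q_def r_def)
    have IH2: "shuffle (shuffle (lmult a p) q) (lmult c r) = shuffle (lmult a p) (shuffle q (lmult c r))"
      using less[of u v' w] by (simp add: u v w p_def q_def r_def)
    have IH3: "shuffle (shuffle (lmult a p) (lmult b q)) r = shuffle (lmult a p) (shuffle (lmult b q) r)"
      using less[of u v w'] by (simp add: u v w p_def q_def r_def)
    have "shuffle (shuffle (lmult a p) (lmult b q)) (lmult c r) =
        lmult a (shuffle (shuffle p (lmult b q)) (lmult c r)) +
        lmult b (shuffle (shuffle (lmult a p) q) (lmult c r)) +
        lmult c (shuffle (shuffle (lmult a p) (lmult b q)) r)"
      by (simp add: shuffle_lmult_lmult shuffle_add_left lmult_add)
    also have "\<dots> = shuffle (lmult a p) (shuffle (lmult b q) (lmult c r))"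
      unfolding IH1 IH2 IH3 by (simp add: shuffle_lmult_lmult shuffle_add_right lmult_add)
    finally show ?thesis
      by (simp only: words)
  qed
qed

lemma shuffle_assoc: "shuffle (shuffle p q) r = shuffle p (shuffle q r)"
proof (induction p rule: ncpoly_induct)
  case (word u)
  show ?case
  proof (induction q rule: ncpoly_induct)
    case (word v)
    show ?case
      by (induction r rule: ncpoly_induct) (simp_all add: shuffle_bilinear shuffle_assoc_words)
  qed (simp_all add: shuffle_bilinear)
qed (simp_all add: shuffle_bilinear)

section \<open>Shuffles as lists of words\<close>

text \<open>A list records the multiplicities without rational coefficients, so the same shuffles
  can index sums in \<open>ennreal\<close>, and properties of the individual words can be
  stated.\<close>

fun shuffle_list :: "'a list \<Rightarrow> 'a list \<Rightarrow> 'a list list" where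
  "shuffle_list [] v = [v]"
| "shuffle_list u [] = [u]"
| "shuffle_list (a # u) (b # v) =
     map ((#) a) (shuffle_list u (b # v)) @ map ((#) b) (shuffle_list (a # u) v)"

lemma lmult_sum_list_words:
  "lmult a (\<Sum>w\<leftarrow>ws. word w) = (\<Sum>w\<leftarrow>map ((#) a) ws. word w)"
proof (induction ws)
  case Nil
  show ?case by (simp add: lmult_def)
qed (simp add: lmult_add)

lemma shuffle_words_eq_sum_list: "shuffle_words u v = (\<Sum>w\<leftarrow>shuffle_list u v. word w)"
  by (induction u v rule: shuffle_words.induct)
    (simp_all add: lmult_sum_list_words del: map_map)

lemma shuffle_list_hd:
  assumes "w \<in> set (shuffle_list u v)" "u \<noteq> []" "v \<noteq> []"
  shows "hd w \<in> {hd u, hd v}"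
  using assms by (cases u; cases v) auto

text \<open>Shuffling only interleaves letters. This gives nonemptiness below and, later,
  multiplicativity of the sign.\<close>

lemma shuffle_list_mset:
  assumes "w \<in> set (shuffle_list u v)"
  shows "mset w = mset u + mset v"
  using assms by (induction u v arbitrary: w rule: shuffle_list.induct) auto

lemma shuffle_list_last:
  assumes "w \<in> set (shuffle_list u v)" "u \<noteq> []" "v \<noteq> []"
  shows "last w \<in> {last u, last v}"
  using assms
proof (induction u v arbitrary: w rule: shuffle_list.induct)
  case (3 a u b v)
  from "3.prems"(1) consider
      w' where "w = a # w'" "w' \<in> set (shuffle_list u (b # v))"
    | w' where "w = b # w'" "w' \<in> set (shuffle_list (a # u) v)"
    by auto
  then show ?case
  proof cases
    case 1
    moreover have "w' \<noteq> []"
      using shuffle_list_mset[OF 1(2)] by auto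
    ultimately show ?thesis
      \<comment> \<open>For \<open>u = []\<close> the induction hypothesis says nothing, but then
        \<open>w'\<close> is \<open>b # v\<close> itself.\<close>
      using "3.IH"(1)[OF 1(2)] by (cases "u = []") auto
  next
    case 2
    moreover have "w' \<noteq> []"
      using shuffle_list_mset[OF 2(2)] by auto
    ultimately show ?thesis
      using "3.IH"(2)[OF 2(2)] by (cases "v = []") auto
  qed
qed auto

text \<open>Admissibility constrains only the first and the last letter, and each of these is
  inherited from \<open>u\<close> or from \<open>v\<close>.\<close>

lemma admissible_shuffle_list:
  assumes "admissible u" "admissible v" "w \<in> set (shuffle_list u v)"
  shows "admissible w"
proof (cases "u = [] \<or> v = []")
  case True
  with assms show ?thesis by (cases u; cases v) auto
next
  case False
  then show ?thesis
    using shuffle_list_hd[OF assms(3)] shuffle_list_last[OF assms(3)] assms(1,2)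
    unfolding admissible_def by auto
qed

section \<open>The span of the admissible words\<close>

lemma admissible_span_closed:
  shows "admissible w \<Longrightarrow> word w \<in> admissible_span"
    and "0 \<in> admissible_span"
    and "p \<in> admissible_span \<Longrightarrow> q \<in> admissible_span \<Longrightarrow> p + q \<in> admissible_span"
    and "p \<in> admissible_span \<Longrightarrow> nc_scale c p \<in> admissible_span"
    and "p \<in> admissible_span \<Longrightarrow> - p \<in> admissible_span"
  unfolding admissible_span_def
  by (blast intro: ncpoly.span_base ncpoly.span_zero ncpoly.span_add ncpoly.span_scale
      ncpoly.span_neg)+

lemma admissible_span_induct [consumes 1, case_names word zero add scale]:
  assumes "p \<in> admissible_span"
    and word: "\<And>w. admissible w \<Longrightarrow> P (word w)"
    and zero: "P 0"
    and add: "\<And>p q. P p \<Longrightarrow> P q \<Longrightarrow> P (p + q)"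
    and scale: "\<And>c p. P p \<Longrightarrow> P (nc_scale c p)"
  shows "P p"
  using assms(1)[unfolded admissible_span_def]
proof (induction rule: ncpoly.span_induct_alt)
  case (step c x y)
  then show ?case
    using word scale add by blast
qed (fact zero)

lemma shuffle_zero [simp]: "shuffle 0 q = 0" "shuffle p 0 = 0"
  by (simp_all add: shuffle_def)

lemma shuffle_words_in_admissible_span:
  assumes "admissible u" "admissible v"
  shows "shuffle_words u v \<in> admissible_span"
proof -
  have "(\<Sum>w\<leftarrow>ws. word w) \<in> admissible_span" if "\<forall>w\<in>set ws. admissible w" for ws
    using that by (induction ws) (simp_all add: admissible_span_closed)
  moreover have "\<forall>w\<in>set (shuffle_list u v). admissible w"
    using admissible_shuffle_list[OF assms] by blast
  ultimately show ?thesis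
    unfolding shuffle_words_eq_sum_list by blast
qed

lemma shuffle_in_admissible_span:
  assumes "p \<in> admissible_span" "q \<in> admissible_span"
  shows "shuffle p q \<in> admissible_span"
  using assms(1)
proof (induction rule: admissible_span_induct)
  case (word u)
  show ?case
    using assms(2)
  proof (induction rule: admissible_span_induct)
    case (word v)
    with \<open>admissible u\<close> show ?case
      by (simp add: shuffle_word_word shuffle_words_in_admissible_span)
  qed (simp_all add: shuffle_bilinear admissible_span_closed)
qed (simp_all add: shuffle_bilinear admissible_span_closed)

section \<open>Linearity of \<open>M\<close>\<close>

lemma M_word [simp]: "M (word w) = word_integral w"
  by (simp add: M_def)

lemma M_add: "M (p + q) = M p + M q"
  unfolding M_def by (rule setsum_keys_plus_distrib) (simp_all add: of_rat_add distrib_right)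

lemma M_scale: "M (nc_scale c p) = of_rat c * M p"
  unfolding M_def by (subst sum_keys_nc_scale) (simp_all add: of_rat_mult sum_distrib_left mult.assoc)

lemma M_zero [simp]: "M 0 = 0"
  by (simp add: M_def)

lemma M_sum_list_words: "M (\<Sum>w\<leftarrow>ws. word w) = (\<Sum>w\<leftarrow>ws. word_integral w)"
  by (induction ws) (simp_all add: M_add)

section \<open>The algebra structures\<close>

lemma cring_rat_ring: "cring rat_ring"
proof (intro cringI abelian_groupI comm_monoidI)
  fix x assume "x \<in> carrier rat_ring"
  show "\<exists>y\<in>carrier rat_ring. y \<oplus>\<^bsub>rat_ring\<^esub> x = \<zero>\<^bsub>rat_ring\<^esub>"
    by (intro bexI[of _ "- x"]) (simp_all add: rat_ring_def)
qed (simp_all add: rat_ring_def algebra_simps)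

lemma algebra_real_rat_algebra: "Module.algebra rat_ring real_rat_algebra"
proof (rule algebraI)
  show "cring real_rat_algebra"
  proof (intro cringI abelian_groupI comm_monoidI)
    fix x assume "x \<in> carrier real_rat_algebra"
    show "\<exists>y\<in>carrier real_rat_algebra. y \<oplus>\<^bsub>real_rat_algebra\<^esub> x = \<zero>\<^bsub>real_rat_algebra\<^esub>"
      by (intro bexI[of _ "- x"]) (simp_all add: real_rat_algebra_def)
  qed (simp_all add: real_rat_algebra_def algebra_simps)
qed (simp_all add: cring_rat_ring, simp_all add: rat_ring_def real_rat_algebra_def of_rat_add of_rat_mult algebra_simps)

lemma algebra_admissible_algebra: "Module.algebra rat_ring admissible_algebra"
proof (rule algebraI)
  note closed = admissible_span_closed(2-5)
  have one: "word [] \<in> admissible_span"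
    by (simp add: admissible_span_closed admissible_def)
  show "cring admissible_algebra"
  proof (intro cringI abelian_groupI comm_monoidI)
    fix x assume "x \<in> carrier admissible_algebra"
    then show "\<exists>y\<in>carrier admissible_algebra. y \<oplus>\<^bsub>admissible_algebra\<^esub> x = \<zero>\<^bsub>admissible_algebra\<^esub>"
      by (intro bexI[of _ "- x"]) (simp_all add: admissible_algebra_def closed)
  next
    fix x y
    show "x \<otimes>\<^bsub>admissible_algebra\<^esub> y = y \<otimes>\<^bsub>admissible_algebra\<^esub> x"
      by (simp add: admissible_algebra_def shuffle_commute)
  qed (simp_all add: admissible_algebra_def closed one shuffle_in_admissible_span shuffle_assoc
      shuffle_one_left shuffle_add_left add_ac)
  show "c \<odot>\<^bsub>admissible_algebra\<^esub> x \<in> carrier admissible_algebra"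
    if "x \<in> carrier admissible_algebra" for c x
    using that by (simp add: admissible_algebra_def closed)
qed (simp_all add: cring_rat_ring, simp_all add: rat_ring_def admissible_algebra_def
    shuffle_scale_left ncpoly.scale_left_distrib ncpoly.scale_right_distrib)

section \<open>Iterated integrals of nonnegative functions\<close>

lemma nn_integral_mult_triangle:
  fixes f g :: "real \<Rightarrow> ennreal"
  assumes [measurable]: "f \<in> borel_measurable borel" "g \<in> borel_measurable borel"
  shows "(\<integral>\<^sup>+s. f s * indicator {0<..<x} s \<partial>lborel) * (\<integral>\<^sup>+t. g t * indicator {0<..<x} t \<partial>lborel) =
    (\<integral>\<^sup>+s. f s * (\<integral>\<^sup>+t. g t * indicator {0<..<s} t \<partial>lborel) * indicator {0<..<x} s \<partial>lborel) +
    (\<integral>\<^sup>+t. g t * (\<integral>\<^sup>+s. f s * indicator {0<..<t} s \<partial>lborel) * indicator {0<..<x} t \<partial>lborel)"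
proof -
  \<comment> \<open>\<open>?h\<close> lives on the triangle \<open>t < s\<close>, and
    \<open>?k\<close> on \<open>s \<le> t\<close> with the diagonal included, which makes the
    splitting of the square exact at every point.\<close>
  let ?h = "\<lambda>s t. f s * g t * (if 0 < t \<and> t < s \<and> s < x then 1 else 0)"
  let ?k = "\<lambda>s t. f s * g t * (if 0 < s \<and> s \<le> t \<and> t < x then 1 else 0)"
  have "(\<integral>\<^sup>+s. f s * indicator {0<..<x} s \<partial>lborel) * (\<integral>\<^sup>+t. g t * indicator {0<..<x} t \<partial>lborel) =
      (\<integral>\<^sup>+s. \<integral>\<^sup>+t. f s * indicator {0<..<x} s * (g t * indicator {0<..<x} t) \<partial>lborel \<partial>lborel)"
    by (simp add: nn_integral_cmult nn_integral_multc)
  also have "\<dots> = (\<integral>\<^sup>+s. \<integral>\<^sup>+t. ?h s t + ?k s t \<partial>lborel \<partial>lborel)"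
    by (intro nn_integral_cong) (auto simp: indicator_def)
  also have "\<dots> = (\<integral>\<^sup>+s. \<integral>\<^sup>+t. ?h s t \<partial>lborel \<partial>lborel) + (\<integral>\<^sup>+s. \<integral>\<^sup>+t. ?k s t \<partial>lborel \<partial>lborel)"
    by (simp add: nn_integral_add)
  also have "(\<integral>\<^sup>+s. \<integral>\<^sup>+t. ?k s t \<partial>lborel \<partial>lborel) = (\<integral>\<^sup>+t. \<integral>\<^sup>+s. ?k s t \<partial>lborel \<partial>lborel)"
    by (rule lborel_pair.Fubini') measurable
  also have "(\<integral>\<^sup>+s. \<integral>\<^sup>+t. ?h s t \<partial>lborel \<partial>lborel) =
      (\<integral>\<^sup>+s. f s * (\<integral>\<^sup>+t. g t * indicator {0<..<s} t \<partial>lborel) * indicator {0<..<x} s \<partial>lborel)"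
  proof (intro nn_integral_cong)
    fix s :: real
    have "(\<integral>\<^sup>+t. ?h s t \<partial>lborel) = (\<integral>\<^sup>+t. (f s * indicator {0<..<x} s) * (g t * indicator {0<..<s} t) \<partial>lborel)"
      by (intro nn_integral_cong) (auto simp: indicator_def)
    also have "\<dots> = (f s * indicator {0<..<x} s) * (\<integral>\<^sup>+t. g t * indicator {0<..<s} t \<partial>lborel)"
      by (rule nn_integral_cmult) measurable
    finally show "(\<integral>\<^sup>+t. ?h s t \<partial>lborel) = f s * (\<integral>\<^sup>+t. g t * indicator {0<..<s} t \<partial>lborel) * indicator {0<..<x} s"
      by (simp only: mult_ac)
  qed
  also have "(\<integral>\<^sup>+t. \<integral>\<^sup>+s. ?k s t \<partial>lborel \<partial>lborel) =
      (\<integral>\<^sup>+t. g t * (\<integral>\<^sup>+s. f s * indicator {0<..<t} s \<partial>lborel) * indicator {0<..<x} t \<partial>lborel)"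
  proof (intro nn_integral_cong)
    fix t :: real
    have "(\<integral>\<^sup>+s. ?k s t \<partial>lborel) = (\<integral>\<^sup>+s. (g t * indicator {0<..<x} t) * (f s * indicator {0<..<t} s) \<partial>lborel)"
      \<comment> \<open>The diagonal \<open>s = t\<close> is a single point for fixed
        \<open>t\<close>; discarding it turns \<open>s \<le> t\<close> into
        \<open>s < t\<close>.\<close>
      by (intro nn_integral_cong_AE) (use AE_lborel_singleton[of t] in eventually_elim, auto simp: indicator_def mult_ac)
    also have "\<dots> = (g t * indicator {0<..<x} t) * (\<integral>\<^sup>+s. f s * indicator {0<..<t} s \<partial>lborel)"
      by (rule nn_integral_cmult) measurable
    finally show "(\<integral>\<^sup>+s. ?k s t \<partial>lborel) = g t * (\<integral>\<^sup>+s. f s * indicator {0<..<t} s \<partial>lborel) * indicator {0<..<x} t"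
      by (simp only: mult_ac)
  qed
  finally show ?thesis .
qed

text \<open>The first letter carries the outermost variable, and the upper limit stays free because
  the inner integral is taken up to that variable. Values in \<open>ennreal\<close> always
  exist.\<close>

fun iter_int :: "('a \<Rightarrow> real \<Rightarrow> ennreal) \<Rightarrow> 'a list \<Rightarrow> real \<Rightarrow> ennreal" where
  "iter_int f [] x = 1"
| "iter_int f (a # w) x = (\<integral>\<^sup>+t. f a t * iter_int f w t * indicator {0<..<x} t \<partial>lborel)"

lemma borel_measurable_iter_int [measurable]:
  assumes [measurable]: "\<And>a. f a \<in> borel_measurable borel"
  shows "iter_int f w \<in> borel_measurable borel"
proof (induction w)
  case (Cons a w)
  note [measurable] = Cons
  \<comment> \<open>The interval depends on the parameter \<open>x\<close>; written as a condition
    on the pair of \<open>t\<close> and \<open>x\<close>, it is visibly jointly measurable.\<close>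
  have "(\<lambda>x. \<integral>\<^sup>+t. f a t * iter_int f w t * (if 0 < t \<and> t < x then 1 else 0) \<partial>lborel)
      \<in> borel_measurable borel"
    by measurable
  also have "(\<lambda>x. \<integral>\<^sup>+t. f a t * iter_int f w t * (if 0 < t \<and> t < x then 1 else 0) \<partial>lborel) = iter_int f (a # w)"
    by (intro ext) (auto intro!: nn_integral_cong simp: indicator_def)
  finally show ?case .
qed auto

lemma iter_int_sum_list:
  assumes [measurable]: "\<And>a. f a \<in> borel_measurable borel"
  shows "(\<integral>\<^sup>+t. f a t * (\<Sum>w\<leftarrow>ws. iter_int f w t) * indicator {0<..<x} t \<partial>lborel) =
    (\<Sum>w\<leftarrow>ws. iter_int f (a # w) x)"
proof (induction ws)
  case (Cons w ws)
  have [measurable]: "(\<lambda>t. \<Sum>w\<leftarrow>ws. iter_int f w t) \<in> borel_measurable borel"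
    by (induction ws) auto
  show ?case
    using Cons by (simp add: distrib_left distrib_right nn_integral_add)
qed simp

text \<open>The two triangles correspond to the two branches of the shuffle recursion. The induction
  keeps \<open>x\<close> arbitrary, since the inner products are evaluated at the integration
  variable.\<close>

lemma iter_int_mult:
  assumes [measurable]: "\<And>a. f a \<in> borel_measurable borel"
  shows "iter_int f u x * iter_int f v x = (\<Sum>w\<leftarrow>shuffle_list u v. iter_int f w x)"
proof (induction u v arbitrary: x rule: shuffle_list.induct)
  case (3 a u b v)
  have "iter_int f (a # u) x * iter_int f (b # v) x =
      (\<integral>\<^sup>+s. f a s * iter_int f u s * iter_int f (b # v) s * indicator {0<..<x} s \<partial>lborel) +
      (\<integral>\<^sup>+t. f b t * iter_int f v t * iter_int f (a # u) t * indicator {0<..<x} t \<partial>lborel)"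
    unfolding iter_int.simps by (rule nn_integral_mult_triangle) measurable
  also have "\<dots> =
      (\<integral>\<^sup>+s. f a s * (iter_int f u s * iter_int f (b # v) s) * indicator {0<..<x} s \<partial>lborel) +
      (\<integral>\<^sup>+t. f b t * (iter_int f (a # u) t * iter_int f v t) * indicator {0<..<x} t \<partial>lborel)"
    by (simp only: mult_ac)
  also have "\<dots> = (\<Sum>w\<leftarrow>shuffle_list (a # u) (b # v). iter_int f w x)"
    unfolding 3 by (simp add: iter_int_sum_list o_def del: iter_int.simps)
  finally show ?case .
qed simp_all

text \<open>
  The variables are numbered from \<open>k\<close> on, so that splitting off the outermost one leaves a product
  measure over \<open>{Suc k..<Suc k + n}\<close> and requires no reindexing.
\<close>

fun simplex_prod :: "('a \<Rightarrow> real \<Rightarrow> real) \<Rightarrow> 'a list \<Rightarrow> nat \<Rightarrow> real \<Rightarrow> (nat \<Rightarrow> real) \<Rightarrow> real" where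
  "simplex_prod f [] k x t = 1"
| "simplex_prod f (a # w) k x t =
     f a (t k) * indicator {0<..<x} (t k) * simplex_prod f w (Suc k) (t k) t"

text \<open>The nested conditions, each variable lying between \<open>0\<close> and its predecessor,
  amount to the pairwise inequalities of the simplex. For \<open>k = 0\<close> and
  \<open>x = 1\<close> this is the condition in \<open>open_simplex\<close>.\<close>

lemma simplex_prod_eq:
  "simplex_prod f w k x t = (\<Prod>i<length w. f (w ! i) (t (k + i))) *
    indicator {t. (\<forall>i<length w. 0 < t (k + i) \<and> t (k + i) < x) \<and>
      (\<forall>i j. i < j \<and> j < length w \<longrightarrow> t (k + j) < t (k + i))} t"
proof (induction w arbitrary: k x)
  case (Cons a w)
  let ?S = "\<lambda>n k x. (\<forall>i<n. 0 < t (k + i) \<and> t (k + i) < x) \<and>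
      (\<forall>i j. i < j \<and> j < n \<longrightarrow> t (k + j) < t (k + i))"
  have "?S (Suc n) k x \<longleftrightarrow> (0 < t k \<and> t k < x) \<and> ?S n (Suc k) (t k)" for n
  proof (intro iffI conjI allI impI)
    assume S: "?S (Suc n) k x"
    show "0 < t k" "t k < x"
      using S by force+
    fix i assume i: "i < n"
    show "0 < t (Suc k + i)" "t (Suc k + i) < t k"
      using S[THEN conjunct1, rule_format, of "Suc i"] S[THEN conjunct2, rule_format, of 0 "Suc i"] i
      by auto
  next
    fix i j assume S: "?S (Suc n) k x" and "i < j \<and> j < n"
    then show "t (Suc k + j) < t (Suc k + i)"
      using S[THEN conjunct2, rule_format, of "Suc i" "Suc j"] by auto
  next
    fix i assume S: "(0 < t k \<and> t k < x) \<and> ?S n (Suc k) (t k)" and i: "i < Suc n"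
    show "0 < t (k + i)" "t (k + i) < x"
      using S i by (cases i; force)+
  next
    fix i j assume S: "(0 < t k \<and> t k < x) \<and> ?S n (Suc k) (t k)" and ij: "i < j \<and> j < Suc n"
    then obtain j' where "j = Suc j'" "j' < n"
      by (cases j) auto
    with S ij show "t (k + j) < t (k + i)"
      by (cases i) auto
  qed
  then show ?case
    unfolding simplex_prod.simps Cons.IH
    by (simp add: prod.lessThan_Suc_shift indicator_def del: prod.lessThan_Suc)
qed simp

text \<open>The bound is a function \<open>h\<close> because the recursion replaces it by the
  coordinate \<open>t k\<close>; the index set \<open>I\<close> stays fixed while \<open>k\<close>
  grows.\<close>

lemma borel_measurable_simplex_prod:
  assumes [measurable]: "\<And>a. f a \<in> borel_measurable borel"
  assumes "h \<in> borel_measurable (Pi\<^sub>M I (\<lambda>_. lborel))" "{k..<k + length w} \<subseteq> I"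
  shows "(\<lambda>t. simplex_prod f w k (h t) t) \<in> borel_measurable (Pi\<^sub>M I (\<lambda>_. lborel))"
  using assms(2,3)
proof (induction w arbitrary: k h)
  case (Cons a w)
  have "k \<in> I"
    using Cons.prems by auto
  then have tk [measurable]: "(\<lambda>t. t k) \<in> borel_measurable (Pi\<^sub>M I (\<lambda>_. lborel))"
    using measurable_component_singleton[of k I "\<lambda>_. lborel :: real measure"] by simp
  note [measurable] = Cons.prems(1)
  have [measurable]: "(\<lambda>t. simplex_prod f w (Suc k) (t k) t) \<in> borel_measurable (Pi\<^sub>M I (\<lambda>_. lborel))"
    using Cons.prems(2) by (intro Cons.IH tk) auto
  have "(\<lambda>t. f a (t k) * (if 0 < t k \<and> t k < h t then 1 else 0) * simplex_prod f w (Suc k) (t k) t)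
      \<in> borel_measurable (Pi\<^sub>M I (\<lambda>_. lborel))"
    by measurable
  then show ?case
    by (simp add: indicator_def)
qed simp

lemma simplex_prod_fun_upd:
  assumes "j < k"
  shows "simplex_prod f w k x (t(j := y)) = simplex_prod f w k x t"
  using assms by (induction w arbitrary: k x) auto

text \<open>Tonelli splits off coordinate \<open>k\<close>. Its value \<open>y\<close> becomes the
  upper bound for the coordinates from \<open>Suc k\<close> on, which the induction hypothesis
  covers.\<close>

lemma nn_integral_simplex_prod:
  assumes [measurable]: "\<And>a. f a \<in> borel_measurable borel"
  shows "(\<integral>\<^sup>+t. ennreal \<bar>simplex_prod f w k x t\<bar> \<partial>Pi\<^sub>M {k..<k + length w} (\<lambda>_. lborel)) =
    iter_int (\<lambda>a t. ennreal \<bar>f a t\<bar>) w x"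
proof (induction w arbitrary: k x)
  case Nil
  show ?case
    by (simp add: PiM_empty nn_integral_count_space_finite)
next
  case (Cons a w)
  interpret product_sigma_finite "\<lambda>_ :: nat. lborel :: real measure" ..
  have I: "{k..<k + length (a # w)} = insert k {Suc k..<Suc k + length w}"
    by auto
  have [measurable]: "(\<lambda>t. simplex_prod f w (Suc k) y t) \<in>
      borel_measurable (Pi\<^sub>M {Suc k..<Suc k + length w} (\<lambda>_. lborel))" for y
    by (rule borel_measurable_simplex_prod[OF assms]) auto
  have "(\<integral>\<^sup>+t. ennreal \<bar>simplex_prod f (a # w) k x t\<bar> \<partial>Pi\<^sub>M {k..<k + length (a # w)} (\<lambda>_. lborel)) =
      (\<integral>\<^sup>+y. \<integral>\<^sup>+t. ennreal \<bar>simplex_prod f (a # w) k x (t(k := y))\<bar>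
        \<partial>Pi\<^sub>M {Suc k..<Suc k + length w} (\<lambda>_. lborel) \<partial>lborel)"
    unfolding I
    by (intro product_nn_integral_insert_rev measurable_compose[OF _ measurable_ennreal]
        borel_measurable_abs borel_measurable_simplex_prod) auto
  also have "\<dots> = (\<integral>\<^sup>+y. ennreal \<bar>f a y\<bar> * iter_int (\<lambda>a t. ennreal \<bar>f a t\<bar>) w y * indicator {0<..<x} y \<partial>lborel)"
  proof (intro nn_integral_cong)
    fix y
    have "(\<integral>\<^sup>+t. ennreal \<bar>simplex_prod f (a # w) k x (t(k := y))\<bar>
        \<partial>Pi\<^sub>M {Suc k..<Suc k + length w} (\<lambda>_. lborel)) =
      (\<integral>\<^sup>+t. (ennreal \<bar>f a y\<bar> * indicator {0<..<x} y) * ennreal \<bar>simplex_prod f w (Suc k) y t\<bar>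
        \<partial>Pi\<^sub>M {Suc k..<Suc k + length w} (\<lambda>_. lborel))"
      by (intro nn_integral_cong)
        (auto simp: simplex_prod_fun_upd abs_mult ennreal_mult indicator_def)
    also have "\<dots> = (ennreal \<bar>f a y\<bar> * indicator {0<..<x} y) * iter_int (\<lambda>a t. ennreal \<bar>f a t\<bar>) w y"
      unfolding Cons.IH[of "Suc k", symmetric] by (rule nn_integral_cmult) measurable
    finally show "(\<integral>\<^sup>+t. ennreal \<bar>simplex_prod f (a # w) k x (t(k := y))\<bar>
        \<partial>Pi\<^sub>M {Suc k..<Suc k + length w} (\<lambda>_. lborel)) =
      ennreal \<bar>f a y\<bar> * iter_int (\<lambda>a t. ennreal \<bar>f a t\<bar>) w y * indicator {0<..<x} y"
      by (simp add: mult_ac)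
  qed
  finally show ?case by simp
qed

section \<open>Convergence\<close>

lemma borel_measurable_form_coeff [measurable]: "form_coeff a \<in> borel_measurable borel"
  \<comment> \<open>The \<open>0\<close> is a placeholder: the case rule of
    \<open>form_coeff\<close> expects a letter together with an argument.\<close>
  by (cases "(a, 0 :: real)" rule: form_coeff.cases)
    (auto simp: form_coeff.simps[abs_def] cong: measurable_cong)

section \<open>Elementary bounds\<close>

text \<open>Differentiability is asked only in the interior, so that derivatives may blow up at the
  endpoints, as those of square roots do below.\<close>

lemma nn_integral_FTC_Ioo:
  fixes F F' :: "real \<Rightarrow> real"
  assumes "a \<le> b" "continuous_on {a..b} F"
    and "\<And>t. a < t \<Longrightarrow> t < b \<Longrightarrow> (F has_real_derivative F' t) (at t)"
    and "\<And>t. a < t \<Longrightarrow> t < b \<Longrightarrow> 0 \<le> F' t"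
  shows "(\<integral>\<^sup>+t. ennreal (F' t) * indicator {a<..<b} t \<partial>lborel) = ennreal (F b - F a)"
proof (rule nn_integral_has_integral_lebesgue')
  have "(F' has_integral (F b - F a)) {a..b}"
    using assms by (intro fundamental_theorem_of_calculus_interior)
      (auto simp: has_real_derivative_iff_has_vector_derivative)
  then show "(F' has_integral (F b - F a)) {a<..<b}"
    by (simp add: has_integral_Icc_iff_Ioo)
qed (use assms in auto)

text \<open>Only \<open>Om0\<close> has a pole at \<open>0\<close>, and only the letters
  \<open>Om Plus _\<close> have one at \<open>1\<close>. The four bounds serve, in order, an
  arbitrary letter, the last letter, the first letter, and a letter that is both first and
  last.\<close>

lemma abs_form_coeff_le:
  assumes "0 < t" "t < 1"
  shows "\<bar>form_coeff a t\<bar> \<le> 2 / (t * (1 - t))"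
    and "a \<noteq> Om0 \<Longrightarrow> \<bar>form_coeff a t\<bar> \<le> 2 / (1 - t)"
    and "a \<noteq> Om Plus Plus \<Longrightarrow> a \<noteq> Om Plus Minus \<Longrightarrow> \<bar>form_coeff a t\<bar> \<le> 2 / t"
    and "a \<noteq> Om0 \<Longrightarrow> a \<noteq> Om Plus Plus \<Longrightarrow> a \<noteq> Om Plus Minus \<Longrightarrow> \<bar>form_coeff a t\<bar> \<le> 2"
proof -
  have "t\<^sup>2 \<le> t"
    using assms by (simp add: power2_eq_square mult_left_le)
  then have pos: "0 < 1 - t" "0 < 1 - t\<^sup>2" "1 - t \<le> 1 - t\<^sup>2"
    using assms by linarith+
  have plus: "\<bar>2 / (1 - t\<^sup>2)\<bar> \<le> 2 / (1 - t)" "\<bar>2 * t / (1 - t\<^sup>2)\<bar> \<le> 2 / (1 - t)"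
    using pos assms by (auto simp: abs_of_pos intro!: frac_le)
  have le: "t * 2 \<le> 2 + 2 * t\<^sup>2"
    using assms zero_le_power2[of t] by linarith
  have minus: "\<bar>- 2 / (1 + t\<^sup>2)\<bar> \<le> 2" "\<bar>- 2 * t / (1 + t\<^sup>2)\<bar> \<le> 2"
    using assms le by (auto simp: abs_mult field_simps add_nonneg_pos)
  have "0 < t * (1 - t)" "t * (1 - t) \<le> t" "t * (1 - t) \<le> 1 - t"
    using assms by (auto simp: mult_left_le mult_left_le_one_le)
  then have "2 / t \<le> 2 / (t * (1 - t))" "2 / (1 - t) \<le> 2 / (t * (1 - t))"
    by (auto intro!: frac_le)
  moreover have "2 \<le> 2 / t" "2 \<le> 2 / (1 - t)" "1 / t \<le> 2 / t" "\<bar>1 / t\<bar> = 1 / t"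
    using assms by (auto simp: field_simps)
  ultimately have two: "2 \<le> 2 / t" "2 \<le> 2 / (1 - t)" "1 / t \<le> 2 / t" "\<bar>1 / t\<bar> = 1 / t"
      "2 / t \<le> 2 / (t * (1 - t))" "2 / (1 - t) \<le> 2 / (t * (1 - t))"
    by blast+
  consider (Om0) "a = Om0" "\<bar>form_coeff a t\<bar> = 1 / t"
    | (Plus) "a = Om Plus Plus \<or> a = Om Plus Minus" "a \<noteq> Om0" "\<bar>form_coeff a t\<bar> \<le> 2 / (1 - t)"
    | (Minus) "\<bar>form_coeff a t\<bar> \<le> 2"
    using plus minus assms
    by (cases "(a, t)" rule: form_coeff.cases) (simp_all only: form_coeff.simps, auto)
  note cases = this
  show "\<bar>form_coeff a t\<bar> \<le> 2 / (t * (1 - t))"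
    by (cases rule: cases) (use two in linarith)+
  show "\<bar>form_coeff a t\<bar> \<le> 2 / (1 - t)" if "a \<noteq> Om0"
    by (cases rule: cases) (use that in blast, use two in linarith, use two in linarith)
  show "\<bar>form_coeff a t\<bar> \<le> 2 / t" if "a \<noteq> Om Plus Plus" "a \<noteq> Om Plus Minus"
    by (cases rule: cases) (use two in linarith, use that in blast, use two in linarith)
  show "\<bar>form_coeff a t\<bar> \<le> 2" if "a \<noteq> Om0" "a \<noteq> Om Plus Plus" "a \<noteq> Om Plus Minus"
    by (cases rule: cases) (use that in blast)+
qed

section \<open>Finiteness for admissible words\<close>

definition abs_iter_int :: "letter list \<Rightarrow> real \<Rightarrow> ennreal" where
  "abs_iter_int = iter_int (\<lambda>a t. ennreal \<bar>form_coeff a t\<bar>)"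

text \<open>The integrand is dominated by \<open>F'\<close>, which integrates to
  \<open>F x - F 0\<close>. Bounding a longer word thus reduces to finding a suitable
  antiderivative.\<close>

lemma abs_iter_int_Cons_le:
  assumes "0 \<le> x" "continuous_on {0..x} F"
    and "\<And>t. 0 < t \<Longrightarrow> t < x \<Longrightarrow> (F has_real_derivative F' t) (at t)"
    and "\<And>t. 0 < t \<Longrightarrow> t < x \<Longrightarrow> abs_iter_int w t \<le> ennreal (B t)"
    and "\<And>t. 0 < t \<Longrightarrow> t < x \<Longrightarrow> 0 \<le> B t"
    and "\<And>t. 0 < t \<Longrightarrow> t < x \<Longrightarrow> \<bar>form_coeff a t\<bar> * B t \<le> F' t"
  shows "abs_iter_int (a # w) x \<le> ennreal (F x - F 0)"
proof -
  have "abs_iter_int (a # w) x \<le> (\<integral>\<^sup>+t. ennreal (F' t) * indicator {0<..<x} t \<partial>lborel)"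
    unfolding abs_iter_int_def iter_int.simps
  proof (intro nn_integral_mono)
    fix t
    show "ennreal \<bar>form_coeff a t\<bar> * iter_int (\<lambda>a t. ennreal \<bar>form_coeff a t\<bar>) w t * indicator {0<..<x} t
        \<le> ennreal (F' t) * indicator {0<..<x} t"
    proof (cases "t \<in> {0<..<x}")
      case True
      then have "ennreal \<bar>form_coeff a t\<bar> * abs_iter_int w t \<le> ennreal \<bar>form_coeff a t\<bar> * ennreal (B t)"
        using assms by (intro mult_left_mono) auto
      also have "\<dots> \<le> ennreal (F' t)"
        using True assms by (simp flip: ennreal_mult add: ennreal_leI)
      finally show ?thesis
        using True by (simp add: abs_iter_int_def)
    qed simp
  qed
  also have "\<dots> = ennreal (F x - F 0)"
  proof (rule nn_integral_FTC_Ioo)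
    fix t assume t: "0 < t" "t < x"
    have "0 \<le> \<bar>form_coeff a t\<bar> * B t"
      using assms(5) t by simp
    then show "0 \<le> F' t"
      using assms(6)[OF t] by linarith
  qed (use assms in auto)
  finally show ?thesis .
qed

text \<open>
  The majorant \<open>\<Phi> t = sqrt (t / (1 - t))\<close> satisfies \<open>\<Phi>' t = \<Phi> t / (2 * t * (1 - t))\<close>, and every letter is
  bounded by \<open>2 / (t * (1 - t))\<close>, so prepending a letter costs only a factor \<open>4\<close>.
\<close>

lemma abs_iter_int_le:
  assumes "w \<noteq> []" "last w \<noteq> Om0" "0 \<le> x" "x < 1"
  shows "abs_iter_int w x \<le> ennreal (4 ^ length w * sqrt (x / (1 - x)))"
  using assms
proof (induction w arbitrary: x)
  case (Cons a w)
  let ?\<Phi> = "\<lambda>t::real. sqrt (t / (1 - t))"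
  let ?F = "\<lambda>t. 4 ^ length (a # w) * ?\<Phi> t"
  let ?F' = "\<lambda>t. 4 ^ length w * (2 / (t * (1 - t)) * ?\<Phi> t)"
  have deriv: "(?F has_real_derivative ?F' t) (at t)" if "0 < t" "t < x" for t
  proof -
    have t: "t < 1" using that Cons.prems by linarith
    then have "0 < t / (1 - t)" using that by simp
    have "((\<lambda>t. t / (1 - t)) has_real_derivative 1 / (1 - t)\<^sup>2) (at t)"
      using t by (auto intro!: derivative_eq_intros simp: power2_eq_square)
    from DERIV_cmult[OF DERIV_chain2[OF DERIV_real_sqrt[OF \<open>0 < t / (1 - t)\<close>] this]]
    have "(?F has_real_derivative
        4 ^ length (a # w) * (inverse (sqrt (t / (1 - t))) / 2 * (1 / (1 - t)\<^sup>2))) (at t)" .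
    moreover have "inverse (sqrt (t / (1 - t))) = ?\<Phi> t * ((1 - t) / t)"
    proof -
      have "inverse (sqrt u) = sqrt u * inverse u" if "0 < u" for u :: real
        using that by (simp add: real_div_sqrt field_simps)
      from this[OF \<open>0 < t / (1 - t)\<close>] show ?thesis
        by simp
    qed
    moreover have "4 ^ length (a # w) * (p * (s / t) / 2 * (1 / s\<^sup>2)) = 4 ^ length w * (2 / (t * s) * p)"
      if "0 < s" for p s :: real
      using that by (simp add: power2_eq_square mult_ac)
    from this[of "1 - t" "?\<Phi> t"]
    have "4 ^ length (a # w) * (?\<Phi> t * ((1 - t) / t) / 2 * (1 / (1 - t)\<^sup>2)) = ?F' t"
      using t by simp
    ultimately show ?thesis by simp
  qed
  have cont: "continuous_on {0..x} ?F"
    using Cons.prems by (intro continuous_intros) auto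
  have "abs_iter_int (a # w) x \<le> ennreal (?F x - ?F 0)"
  proof (cases "w = []")
    case True
    show ?thesis
    proof (rule abs_iter_int_Cons_le[where B = "\<lambda>_. 1", OF _ cont deriv])
      fix t assume t: "0 < t" "t < x"
      then have t1: "t < 1" using Cons.prems by linarith
      \<comment> \<open>The last letter is bounded by \<open>2 / (1 - t)\<close>, which equals
        \<open>2 / (t * (1 - t)) * t\<close>; hence \<open>t \<le> ?\<Phi> t\<close>
        suffices.\<close>
      have "t\<^sup>2 \<le> t / (1 - t)"
      proof -
        have "t\<^sup>2 \<le> t" "t \<le> t / (1 - t)"
          using t t1 by (simp_all add: power2_eq_square mult_left_le field_simps)
        then show ?thesis by linarith
      qed
      then have "t \<le> ?\<Phi> t"
        by (rule real_le_rsqrt)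
      then have "2 / (t * (1 - t)) * t \<le> 2 / (t * (1 - t)) * ?\<Phi> t"
        using t t1 by (intro mult_left_mono) simp_all
      moreover have "2 / (t * (1 - t)) * t = 2 / (1 - t)"
        using t by simp
      ultimately have "2 / (1 - t) \<le> 2 / (t * (1 - t)) * ?\<Phi> t"
        by simp
      then show "\<bar>form_coeff a t\<bar> * 1 \<le> ?F' t"
        using abs_form_coeff_le(2)[OF t(1) t1, of a] Cons.prems True by simp
    qed (use Cons.prems True in \<open>auto simp: abs_iter_int_def\<close>)
  next
    case False
    show ?thesis
    proof (rule abs_iter_int_Cons_le[where B = "\<lambda>t. 4 ^ length w * ?\<Phi> t", OF _ cont deriv])
      fix t assume t: "0 < t" "t < x"
      then have t1: "t < 1" using Cons.prems by linarith
      show "abs_iter_int w t \<le> ennreal (4 ^ length w * ?\<Phi> t)"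
        using Cons.IH[of t] Cons.prems False t t1 by simp
      show "0 \<le> 4 ^ length w * ?\<Phi> t"
        using t t1 by simp
      show "\<bar>form_coeff a t\<bar> * (4 ^ length w * ?\<Phi> t) \<le> ?F' t"
        using mult_right_mono[OF abs_form_coeff_le(1)[OF t(1) t1, of a], of "4 ^ length w * ?\<Phi> t"] t t1
        by (simp add: mult_ac)
    qed (use Cons.prems in auto)
  qed
  then show ?case by simp
qed simp

text \<open>The majorant for proper suffixes blows up at \<open>1\<close>, so the first letter is
  treated separately. It has no pole at \<open>1\<close>, and its bound \<open>2 / t\<close> times
  the majorant is a multiple of \<open>1 / sqrt (t * (1 - t))\<close>, which is integrable.\<close>

lemma abs_iter_int_finite:
  assumes "admissible w"
  shows "abs_iter_int w 1 < top_class.top"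
proof (cases w)
  case Nil
  then show ?thesis by (simp add: abs_iter_int_def)
next
  case (Cons a v)
  with assms have a: "a \<noteq> Om Plus Plus" "a \<noteq> Om Plus Minus" and last: "last (a # v) \<noteq> Om0"
    by (auto simp: admissible_def)
  show ?thesis
  proof (cases "v = []")
    case True
    \<comment> \<open>A single letter is both first and last, hence bounded by \<open>2\<close>,
      with antiderivative \<open>2 * t\<close>.\<close>
    have "abs_iter_int (a # v) 1 \<le> ennreal (2 * 1 - 2 * 0)"
    proof (rule abs_iter_int_Cons_le[where B = "\<lambda>_. 1" and F' = "\<lambda>_. 2"])
      show "\<bar>form_coeff a t\<bar> * 1 \<le> 2" if "0 < t" "t < 1" for t
        using abs_form_coeff_le(4)[OF that, of a] a last True by simp
    qed (use True in \<open>auto intro!: continuous_intros derivative_eq_intros simp: abs_iter_int_def\<close>)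
    then show ?thesis
      using Cons by (simp add: le_less_trans)
  next
    case False
    let ?C = "4 ^ length v :: real"
    \<comment> \<open>Antiderivative of \<open>?F'\<close>, which comes from splitting
      \<open>1 / (sqrt t * sqrt (1 - t))\<close> into one term for each endpoint.\<close>
    let ?F = "\<lambda>t::real. ?C * (4 * (sqrt t - sqrt (1 - t)))"
    let ?F' = "\<lambda>t::real. ?C * (2 * (1 / sqrt t + 1 / sqrt (1 - t)))"
    have "abs_iter_int (a # v) 1 \<le> ennreal (?F 1 - ?F 0)"
    proof (rule abs_iter_int_Cons_le[where B = "\<lambda>t. ?C * sqrt (t / (1 - t))" and F' = ?F'])
      fix t :: real assume t: "0 < t" "t < 1"
      show "(?F has_real_derivative ?F' t) (at t)"
        using t by (auto intro!: derivative_eq_intros simp: field_simps)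
      show "abs_iter_int v t \<le> ennreal (?C * sqrt (t / (1 - t)))"
        using abs_iter_int_le[of v t] False last t by simp
      show "0 \<le> ?C * sqrt (t / (1 - t))"
        using t by simp
      \<comment> \<open>Division by \<open>sqrt t * sqrt (1 - t)\<close> yields the
        splitting.\<close>
      have "1 \<le> sqrt t + sqrt (1 - t)"
      proof -
        have "t \<le> sqrt t" "1 - t \<le> sqrt (1 - t)"
          using t by (auto intro!: real_le_rsqrt simp: power2_eq_square mult_left_le)
        then show ?thesis by linarith
      qed
      then have "1 / (sqrt t * sqrt (1 - t)) \<le> 1 / sqrt t + 1 / sqrt (1 - t)"
        using t by (simp add: field_simps)
      moreover have "sqrt (t / (1 - t)) / t = 1 / (sqrt t * sqrt (1 - t))"
        using t by (simp add: real_sqrt_divide field_simps)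
      ultimately have "?C * (2 * (sqrt (t / (1 - t)) / t)) \<le> ?F' t"
        by (intro mult_left_mono) simp_all
      moreover have "2 / t * (?C * sqrt (t / (1 - t))) = ?C * (2 * (sqrt (t / (1 - t)) / t))"
        by simp
      moreover have "\<bar>form_coeff a t\<bar> * (?C * sqrt (t / (1 - t))) \<le> 2 / t * (?C * sqrt (t / (1 - t)))"
        using t by (intro mult_right_mono abs_form_coeff_le(3) a) auto
      ultimately show "\<bar>form_coeff a t\<bar> * (?C * sqrt (t / (1 - t))) \<le> ?F' t"
        by linarith
    qed (auto intro!: continuous_intros)
    then show ?thesis
      using Cons by (simp add: le_less_trans)
  qed
qed

section \<open>Multiplicativity\<close>

fun form_sgn :: "letter \<Rightarrow> real" where
  "form_sgn (Om Minus _) = - 1"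
| "form_sgn _ = 1"

definition word_sgn :: "letter list \<Rightarrow> real" where
  "word_sgn w = (\<Prod>a\<leftarrow>w. form_sgn a)"

lemma form_coeff_eq_sgn:
  assumes "0 < t" "t < 1"
  shows "form_coeff a t = form_sgn a * \<bar>form_coeff a t\<bar>"
proof -
  have "0 < 1 - t\<^sup>2"
    using assms by (simp add: power_less_one_iff)
  moreover have "0 < 1 + t\<^sup>2"
    by (simp add: add_pos_nonneg)
  ultimately show ?thesis
    using assms by (cases "(a, t)" rule: form_coeff.cases) (auto simp: abs_mult)
qed

text \<open>Since \<open>x \<le> 1\<close>, the product vanishes unless its coordinates lie in the
  open unit interval, where each letter has a constant sign.\<close>

lemma simplex_prod_eq_sgn:
  assumes "x \<le> 1"
  shows "simplex_prod form_coeff w k x t = word_sgn w * \<bar>simplex_prod form_coeff w k x t\<bar>"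
  using assms
proof (induction w arbitrary: k x)
  case Nil
  show ?case by (simp add: word_sgn_def)
next
  case (Cons a w)
  show ?case
  proof (cases "0 < t k \<and> t k < x")
    case True
    let ?c = "form_coeff a (t k)" and ?p = "simplex_prod form_coeff w (Suc k) (t k) t"
    have prod: "simplex_prod form_coeff (a # w) k x t = ?c * ?p"
      using True by simp
    also have "\<dots> = (form_sgn a * \<bar>?c\<bar>) * (word_sgn w * \<bar>?p\<bar>)"
      using form_coeff_eq_sgn[of "t k" a] Cons True by simp
    also have "\<dots> = word_sgn (a # w) * \<bar>?c * ?p\<bar>"
      by (simp add: word_sgn_def abs_mult)
    finally show ?thesis
      by (simp only: prod)
  qed simp
qed

section \<open>Word integrals as signed iterated integrals\<close>

lemma indicator_open_simplex_integrand:
  assumes "t \<in> space (lborel_pow (length w))"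
  shows "indicator (open_simplex (length w)) t *\<^sub>R integrand w t = simplex_prod form_coeff w 0 1 t"
  using assms unfolding simplex_prod_eq by (simp add: open_simplex_def integrand_def indicator_def)

lemma borel_measurable_simplex_prod_form_coeff:
  "simplex_prod form_coeff w 0 1 \<in> borel_measurable (lborel_pow (length w))"
  by (rule borel_measurable_simplex_prod[where h = "\<lambda>_. 1"]) auto

lemma nn_integral_simplex_prod_form_coeff:
  "(\<integral>\<^sup>+t. ennreal \<bar>simplex_prod form_coeff w 0 1 t\<bar> \<partial>lborel_pow (length w)) = abs_iter_int w 1"
  using nn_integral_simplex_prod[where f = form_coeff and w = w and k = 0 and x = 1] by (simp add: abs_iter_int_def atLeast0LessThan)

lemma word_convergent_iff: "word_convergent w \<longleftrightarrow> abs_iter_int w 1 < top_class.top"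
proof -
  have "word_convergent w \<longleftrightarrow> integrable (lborel_pow (length w)) (simplex_prod form_coeff w 0 1)"
    unfolding word_convergent_def set_integrable_def
    by (intro Bochner_Integration.integrable_cong refl indicator_open_simplex_integrand)
  also have "\<dots> \<longleftrightarrow> abs_iter_int w 1 < top_class.top"
    using borel_measurable_simplex_prod_form_coeff by (simp add: integrable_iff_bounded nn_integral_simplex_prod_form_coeff)
  finally show ?thesis .
qed

text \<open>On the simplex the integrand is the constant sign times its absolute value. For a
  divergent word both sides are \<open>0\<close>, the default of the integral and of
  \<open>enn2real\<close> at infinity.\<close>

lemma word_integral_eq: "word_integral w = word_sgn w * enn2real (abs_iter_int w 1)"
proof -
  note [measurable] = borel_measurable_simplex_prod_form_coeff
  have "word_integral w = (LINT t|lborel_pow (length w). simplex_prod form_coeff w 0 1 t)"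
    unfolding word_integral_def set_lebesgue_integral_def
    by (intro Bochner_Integration.integral_cong refl indicator_open_simplex_integrand)
  also have "\<dots> = (LINT t|lborel_pow (length w). word_sgn w * \<bar>simplex_prod form_coeff w 0 1 t\<bar>)"
    using simplex_prod_eq_sgn[of 1 w 0] by (intro Bochner_Integration.integral_cong refl) simp
  also have "\<dots> = word_sgn w * (LINT t|lborel_pow (length w). \<bar>simplex_prod form_coeff w 0 1 t\<bar>)"
    by simp
  also have "(LINT t|lborel_pow (length w). \<bar>simplex_prod form_coeff w 0 1 t\<bar>) = enn2real (abs_iter_int w 1)"
    by (subst integral_eq_nn_integral) (auto simp: nn_integral_simplex_prod_form_coeff)
  finally show ?thesis .
qed

text \<open>The sign is a product over the multiset of letters, which shuffling preserves.\<close>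

lemma word_sgn_shuffle_list:
  assumes "w \<in> set (shuffle_list u v)"
  shows "word_sgn w = word_sgn u * word_sgn v"
proof -
  have "word_sgn w = prod_mset (image_mset form_sgn (mset w))" for w
    by (simp add: word_sgn_def flip: prod_mset_prod_list)
  then show ?thesis
    by (simp add: shuffle_list_mset[OF assms])
qed

lemma word_integral_mult:
  assumes "admissible u" "admissible v"
  shows "word_integral u * word_integral v = (\<Sum>w\<leftarrow>shuffle_list u v. word_integral w)"
proof -
  \<comment> \<open>\<open>enn2real\<close> commutes with products, but with sums only when they are
    finite; here admissibility enters, and finiteness of the partial sums is carried through the
    induction.\<close>
  have sum_eq: "(\<Sum>w\<leftarrow>ws. enn2real (abs_iter_int w 1)) = enn2real (\<Sum>w\<leftarrow>ws. abs_iter_int w 1) \<and>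
      (\<Sum>w\<leftarrow>ws. abs_iter_int w 1) < top_class.top" if "\<forall>w\<in>set ws. admissible w" for ws
    using that by (induction ws) (auto simp: enn2real_plus abs_iter_int_finite)
  have "word_integral u * word_integral v =
      word_sgn u * word_sgn v * enn2real (abs_iter_int u 1 * abs_iter_int v 1)"
    by (simp add: word_integral_eq enn2real_mult)
  also have "\<dots> = word_sgn u * word_sgn v * (\<Sum>w\<leftarrow>shuffle_list u v. enn2real (abs_iter_int w 1))"
    using sum_eq admissible_shuffle_list[OF assms] by (simp add: abs_iter_int_def iter_int_mult)
  also have "\<dots> = (\<Sum>w\<leftarrow>shuffle_list u v. word_sgn u * word_sgn v * enn2real (abs_iter_int w 1))"
    by (simp add: sum_list_const_mult)
  also have "\<dots> = (\<Sum>w\<leftarrow>shuffle_list u v. word_integral w)"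
    by (intro arg_cong[where f = sum_list] map_cong refl)
      (simp add: word_integral_eq word_sgn_shuffle_list)
  finally show ?thesis .
qed

text \<open>Both sides are bilinear, so two span inductions reduce the claim to admissible
  words.\<close>

lemma M_shuffle:
  assumes "p \<in> admissible_span" "q \<in> admissible_span"
  shows "M (shuffle p q) = M p * M q"
  using assms(1)
proof (induction rule: admissible_span_induct)
  case (word u)
  show ?case
    using assms(2)
  proof (induction rule: admissible_span_induct)
    case (word v)
    with \<open>admissible u\<close> show ?case
      by (simp add: shuffle_word_word shuffle_words_eq_sum_list M_sum_list_words word_integral_mult)
  qed (simp_all add: shuffle_bilinear M_add M_scale algebra_simps)
qed (simp_all add: shuffle_bilinear M_add M_scale algebra_simps)

text \<open>The first conjunct guarantees that on admissible words the values of \<open>M\<close>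
  are genuine integrals rather than the default \<open>0\<close> of a divergent one.\<close>

theorem proposition2p2:
  "(\<forall>w. admissible w \<longrightarrow> word_convergent w) \<and>
   algebra_hom rat_ring admissible_algebra real_rat_algebra M"
proof (intro conjI allI impI)
  show "word_convergent w" if "admissible w" for w
    using that by (simp add: word_convergent_iff abs_iter_int_finite)
  have "M \<in> ring_hom admissible_algebra real_rat_algebra"
    by (rule ring_hom_memI)
      (simp_all add: admissible_algebra_def real_rat_algebra_def M_shuffle M_add word_integral_Nil)
  then show "algebra_hom rat_ring admissible_algebra real_rat_algebra M"
    unfolding algebra_hom_def
    by (simp add: algebra_admissible_algebra algebra_real_rat_algebra)
      (simp add: admissible_algebra_def real_rat_algebra_def M_scale)
qed

end
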